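(* Let $\mathcal V=\{1,\dots,n\}$ and let $f:2^{\mathcal V}\to\mathbb R_{+}$ be a monotone submodular function with $f(\emptyset)=0$ and curvature $c$. Let $F:[0,1]^n\to\mathbb R_{+}$ be its multi-linear extension, and let $\mathcal C\subseteq[0,1]^n$. If $\mathbf x\in\mathcal C$ is a stationary point of $F$ over $\mathcal C$, then $$F(\mathbf x)\ \ge\ \Big(\frac{1}{1+c}\Big)\max_{\mathbf y\in\mathcal C}F(\mathbf y).$$
   Context: $f$ is submodular if $f(S\cup\{e\})-f(S)\ge f(T\cup\{e\})-f(T)$ for all $S\subseteq T\subseteq\mathcal V$ and $e\in\mathcal V\setminus T$; monotone if $f(S)\le f(T)$ for $S\subseteq T$. The curvature of $f$ is $c:=1-\min_{S\subseteq\mathcal V,\,e\notin S}\frac{f(S\cup\{e\})-f(S)}{f(\{e\})}\in[0,1]$ (the minimum is over pairs with $f(\{e\})>0$; if there are none, $c:=0$). The multi-linear extension is $F(\mathbf x)=\sum_{\mathcal A\subseteq\mathcal V}f(\mathcal A)\prod_{a\in\mathcal A}x_a\prod_{a\notin\mathcal A}(1-x_a)$ for $\mathbf x\in[0,1]^n$; its gradient is that of this polynomial. A point $\mathbf x\in\mathcal C$ is a stationary point of a differentiable function $G:[0,1]^n\to\mathbb R_{+}$ over $\mathcal C\subseteq[0,1]^n$ if $\max_{\mathbf y\in\mathcal C}\langle\mathbf y-\mathbf x,\nabla G(\mathbf x)\rangle\le 0$. If the maximum of $F$ over $\mathcal C$ is not attained, it is read as a supremum, i.e. the conclusion says $F(\mathbf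 x)\ge\frac1{1+c}F(\mathbf y)$ for all $\mathbf y\in\mathcal C$. *)

theory Defs
  imports "HOL-Analysis.Analysis"
begin

text \<open>The ground set \<open>{1,\<dots>,n}\<close> is the universe of a finite type \<open>'n\<close>, with \<open>n = CARD('n)\<close>.\<close>

definition submodular :: "('n::finite set \<Rightarrow> real) \<Rightarrow> bool" where
  "submodular f \<longleftrightarrow>
    (\<forall>S T e. S \<subseteq> T \<longrightarrow> e \<notin> T \<longrightarrow> f (S \<union> {e}) - f S \<ge> f (T \<union> {e}) - f T)"

definition curvature_ratios :: "('n::finite set \<Rightarrow> real) \<Rightarrow> real set" where
  "curvature_ratios f = {(f (S \<union> {e}) - f S) / f {e} | S e. e \<notin> S \<and> f {e} > 0}"

definition curvature :: "('n::finite set \<Rightarrow> real) \<Rightarrow> real" where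
  "curvature f = (if curvature_ratios f = {} then 0 else 1 - Min (curvature_ratios f))"

text \<open>The polynomial is taken on the whole space, so that it has a two-sided gradient also at
  boundary points of the unit cube.\<close>

definition multilinear_extension :: "('n::finite set \<Rightarrow> real) \<Rightarrow> real ^ 'n \<Rightarrow> real" where
  "multilinear_extension f x = (\<Sum>A\<in>UNIV. f A * (\<Prod>a\<in>A. x $ a) * (\<Prod>a\<in>- A. 1 - x $ a))"

text \<open>The maximum of \<open>(y - x) \<bullet> \<nabla>G(x)\<close> over \<open>y \<in> C\<close> being at most \<open>0\<close> is
  stated for each \<open>y\<close>; since \<open>x \<in> C\<close>, that maximum is then attained at \<open>y = x\<close>.\<close>

definition stationary_point :: "(real ^ 'n::finite \<Rightarrow> real) \<Rightarrow> (real ^ 'n) set \<Rightarrow> real ^ 'n \<Rightarrow> bool" where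
  "stationary_point G C x \<longleftrightarrow>
    x \<in> C \<and> (\<exists>g. (GDERIV G x :> g) \<and> (\<forall>y\<in>C. (y - x) \<bullet> g \<le> 0))"

end

theory Submission
  imports Defs
begin

text \<open>
  The partial derivative of \<open>F\<close> in the coordinate \<open>i\<close> is the multilinear extension of the
  marginal gain of \<open>i\<close>; it is antitone on the cube by submodularity and lies between
  \<open>(1 - c) f {i}\<close> and \<open>f {i}\<close>. Changing the coordinates one at a time,
  antitonicity gives \<open>F (x \<or> y) + F (x \<and> y) - 2 F x \<le> (y - x) \<bullet> \<nabla>F x \<le> 0\<close> for the componentwise
  maximum and minimum. The two bounds give
  \<open>F (x \<or> y) - F y \<ge> (1 - c) (\<Sum>i. (x\<^sub>i - y\<^sub>i)\<^sup>+ f {i}) \<ge> (1 - c) (F x - F (x \<and> y))\<close>,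
  and together these yield \<open>F y \<le> (1 + c) F x - c F (x \<and> y) \<le> (1 + c) F x\<close>.
\<close>

section \<open>Marginal gains and the dependence on a single coordinate\<close>

text \<open>Taking \<open>i\<close> out in the second term makes the value independent of whether
  \<open>i \<in> A\<close>, so the multilinear extension of \<open>marginal i f\<close> does not
  involve the coordinate \<open>i\<close>.\<close>

definition marginal :: "'n \<Rightarrow> ('n set \<Rightarrow> real) \<Rightarrow> 'n set \<Rightarrow> real" where
  "marginal i f A = f (insert i A) - f (A - {i})"

text \<open>Each \<open>A\<close> avoiding \<open>i\<close> is paired with
  \<open>insert i A\<close>, which leaves \<open>x $ i\<close> in the first factor only.\<close>

lemma multilinear_extension_split:
  fixes f :: "'n::finite set \<Rightarrow> real"
  shows "multilinear_extension f x =
    (\<Sum>A\<in>Pow (- {i}). (x $ i * f (insert i A) + (1 - x $ i) * f A) *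
      ((\<Prod>a\<in>A. x $ a) * (\<Prod>a\<in>- A - {i}. 1 - x $ a)))"
proof -
  define G where "G A = f A * (\<Prod>a\<in>A. x $ a) * (\<Prod>a\<in>- A. 1 - x $ a)" for A
  have U: "(UNIV :: 'n set set) = Pow (- {i}) \<union> insert i ` Pow (- {i})"
  proof -
    have "B \<in> Pow (- {i}) \<union> insert i ` Pow (- {i})" for B :: "'n set"
    proof (cases "i \<in> B")
      case True
      then have "B = insert i (B - {i})" "B - {i} \<in> Pow (- {i})" by auto
      then show ?thesis by blast
    qed auto
    then show ?thesis by auto
  qed
  have inj: "inj_on (insert i) (Pow (- {i}))"
    by (rule inj_onI) (simp add: subset_Compl_singleton insert_ident)
  have "multilinear_extension f x = sum G UNIV"
    by (simp add: multilinear_extension_def G_def)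
  also have "\<dots> = sum G (Pow (- {i})) + sum G (insert i ` Pow (- {i}))"
    unfolding U by (rule sum.union_disjoint) auto
  also have "\<dots> = (\<Sum>A\<in>Pow (- {i}). G A + G (insert i A))"
    by (simp add: sum.reindex[OF inj] sum.distrib)
  also have "\<dots> = (\<Sum>A\<in>Pow (- {i}). (x $ i * f (insert i A) + (1 - x $ i) * f A) *
      ((\<Prod>a\<in>A. x $ a) * (\<Prod>a\<in>- A - {i}. 1 - x $ a)))"
  proof (rule sum.cong)
    fix A assume "A \<in> Pow (- {i})"
    then have i: "i \<notin> A" by auto
    have 1: "(\<Prod>a\<in>insert i A. x $ a) = x $ i * (\<Prod>a\<in>A. x $ a)"
      using i by simp
    have 2: "(\<Prod>a\<in>- A. 1 - x $ a) = (1 - x $ i) * (\<Prod>a\<in>- A - {i}. 1 - x $ a)"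
      using i by (intro prod.remove) auto
    have 3: "- insert i A = - A - {i}" by auto
    show "G A + G (insert i A) = (x $ i * f (insert i A) + (1 - x $ i) * f A) *
      ((\<Prod>a\<in>A. x $ a) * (\<Prod>a\<in>- A - {i}. 1 - x $ a))"
      unfolding G_def 1 2 3 by (simp add: algebra_simps)
  qed simp
  finally show ?thesis .
qed

text \<open>The split form is affine in the coordinate \<open>i\<close>. Nothing is restricted to
  the cube, so the identity also serves for two-sided derivatives at its boundary.\<close>

lemma multilinear_extension_diff:
  fixes f :: "'n::finite set \<Rightarrow> real"
  assumes "\<And>j. j \<noteq> i \<Longrightarrow> y $ j = x $ j"
  shows "multilinear_extension f y - multilinear_extension f x
    = (y $ i - x $ i) * multilinear_extension (marginal i f) x"
proof -
  define P where "P v A = (\<Prod>a\<in>A. v $ a) * (\<Prod>a\<in>- A - {i}. 1 - v $ a)" for v :: "real ^ 'n" and A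
  have split: "multilinear_extension h v =
    (\<Sum>A\<in>Pow (- {i}). (v $ i * h (insert i A) + (1 - v $ i) * h A) * P v A)" for h v
    unfolding P_def by (rule multilinear_extension_split)
  have P: "P y A = P x A" if "A \<in> Pow (- {i})" for A
  proof -
    have "y $ a = x $ a" if "a \<in> A \<union> (- A - {i})" for a
      using assms[of a] that \<open>A \<in> Pow (- {i})\<close> by blast
    then show ?thesis
      unfolding P_def by simp
  qed
  have "multilinear_extension f y - multilinear_extension f x =
      (\<Sum>A\<in>Pow (- {i}). (y $ i - x $ i) * ((f (insert i A) - f A) * P x A))"
    unfolding split sum_subtractf[symmetric]
    by (rule sum.cong) (simp_all only: P, simp add: algebra_simps)
  also have "\<dots> = (y $ i - x $ i) * (\<Sum>A\<in>Pow (- {i}). (f (insert i A) - f A) * P x A)"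
    by (rule sum_distrib_left[symmetric])
  \<comment> \<open>\<open>marginal i f\<close> agrees on \<open>A\<close> and
    \<open>insert i A\<close>, so the factors \<open>x $ i\<close> and \<open>1 - x $ i\<close> add
    up to 1.\<close>
  also have "(\<Sum>A\<in>Pow (- {i}). (f (insert i A) - f A) * P x A) = multilinear_extension (marginal i f) x"
    unfolding split
  proof (rule sum.cong)
    fix A assume "A \<in> Pow (- {i})"
    then have "A - {i} = A" by blast
    then have "marginal i f (insert i A) = f (insert i A) - f A" "marginal i f A = f (insert i A) - f A"
      by (simp_all add: marginal_def)
    then show "(f (insert i A) - f A) * P x A
        = (x $ i * marginal i f (insert i A) + (1 - x $ i) * marginal i f A) * P x A"
      by (simp only:) (simp add: algebra_simps)
  qed simp
  finally show ?thesis .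
qed

section \<open>Comparison of values on the unit cube\<close>

lemma mem_unit_cube: "x \<in> cbox 0 1 \<longleftrightarrow> (\<forall>i. 0 \<le> x $ i \<and> x $ i \<le> 1)"
  for x :: "real ^ 'n::finite"
  by (simp add: mem_box_cart)

text \<open>The weights of the sets \<open>A\<close> are the terms in the expansion of the product
  of all \<open>x $ a + (1 - x $ a)\<close>.\<close>

lemma multilinear_extension_const: "multilinear_extension (\<lambda>A. a) x = a"
  for x :: "real ^ 'n::finite"
proof -
  have "(\<Sum>A\<in>UNIV. (\<Prod>a\<in>A. x $ a) * (\<Prod>a\<in>- A. 1 - x $ a)) = 1"
    using prod_add[of UNIV "\<lambda>a. x $ a" "\<lambda>a. 1 - x $ a"] by (simp add: Compl_eq_Diff_UNIV)
  then show ?thesis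
    by (simp add: multilinear_extension_def mult.assoc flip: sum_distrib_left)
qed

lemma multilinear_extension_mono:
  fixes f g :: "'n::finite set \<Rightarrow> real"
  assumes "x \<in> cbox 0 1" and "\<And>A. f A \<le> g A"
  shows "multilinear_extension f x \<le> multilinear_extension g x"
  unfolding multilinear_extension_def
  using assms by (intro sum_mono mult_right_mono prod_nonneg) (auto simp: mem_unit_cube)

text \<open>The coordinates are switched from \<open>x\<close> to \<open>z\<close> one at a time.
  Each switch is exact by affinity, and \<open>w i\<close> is the point reached just before the
  coordinate \<open>i\<close> changes.\<close>

lemma multilinear_extension_mean_value:
  fixes f :: "'n::finite set \<Rightarrow> real"
  assumes "x \<le> z"
  obtains w where "\<And>i. x \<le> w i" "\<And>i. w i \<le> z"
    "multilinear_extension f z - multilinear_extension f x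
      = (\<Sum>i\<in>UNIV. (z $ i - x $ i) * multilinear_extension (marginal i f) (w i))"
proof -
  define v where "v S = (\<chi> i. if i \<in> S then z $ i else x $ i)" for S
  have v: "x \<le> v S" "v S \<le> z" for S
    using assms by (auto simp: less_eq_vec_def v_def)
  have v_ends: "v {} = x" "v UNIV = z"
    by (simp_all add: v_def)
  have "\<exists>w. (\<forall>i. x \<le> w i \<and> w i \<le> z) \<and> multilinear_extension f (v S) - multilinear_extension f x
      = (\<Sum>i\<in>S. (z $ i - x $ i) * multilinear_extension (marginal i f) (w i))"
    if "finite S" for S
    using that
  proof (induction S)
    case empty
    show ?case using assms by (auto simp: v_ends)
  next
    case (insert i S)
    then obtain w where w: "\<And>i. x \<le> w i \<and> w i \<le> z"
      "multilinear_extension f (v S) - multilinear_extension f x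
        = (\<Sum>i\<in>S. (z $ i - x $ i) * multilinear_extension (marginal i f) (w i))"
      by blast
    have "multilinear_extension f (v (insert i S)) - multilinear_extension f (v S)
      = (z $ i - x $ i) * multilinear_extension (marginal i f) (v S)"
      using insert.hyps multilinear_extension_diff[of i "v (insert i S)" "v S" f]
      by (simp add: v_def)
    moreover have "(\<Sum>j\<in>S. (z $ j - x $ j) * multilinear_extension (marginal j f) ((w(i := v S)) j))
      = (\<Sum>j\<in>S. (z $ j - x $ j) * multilinear_extension (marginal j f) (w j))"
      using insert.hyps by (intro sum.cong) auto
    ultimately have "multilinear_extension f (v (insert i S)) - multilinear_extension f x
        = (\<Sum>j\<in>insert i S. (z $ j - x $ j) * multilinear_extension (marginal j f) ((w(i := v S)) j))"
      using insert.hyps w(2) by simp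
    moreover have "\<forall>j. x \<le> (w(i := v S)) j \<and> (w(i := v S)) j \<le> z"
      using w(1) v by simp
    ultimately show ?case by blast
  qed
  from this[of UNIV] show thesis
    using that by (auto simp: v_ends)
qed

text \<open>The intermediate points are known only to lie between \<open>x\<close> and
  \<open>z\<close>, hence the premises over the whole interval. The factors
  \<open>z $ i - x $ i\<close> are nonnegative.\<close>

lemma multilinear_extension_increment_bounds:
  fixes f :: "'n::finite set \<Rightarrow> real"
  assumes "x \<le> z"
  shows multilinear_extension_increment_ge:
    "(\<And>w i. x \<le> w \<Longrightarrow> w \<le> z \<Longrightarrow> a i \<le> multilinear_extension (marginal i f) w) \<Longrightarrow>
      (\<Sum>i\<in>UNIV. (z $ i - x $ i) * a i) \<le> multilinear_extension f z - multilinear_extension f x"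
    and multilinear_extension_increment_le:
    "(\<And>w i. x \<le> w \<Longrightarrow> w \<le> z \<Longrightarrow> multilinear_extension (marginal i f) w \<le> a i) \<Longrightarrow>
      multilinear_extension f z - multilinear_extension f x \<le> (\<Sum>i\<in>UNIV. (z $ i - x $ i) * a i)"
proof -
  obtain w where w: "\<And>i. x \<le> w i" "\<And>i. w i \<le> z"
    and eq: "multilinear_extension f z - multilinear_extension f x
      = (\<Sum>i\<in>UNIV. (z $ i - x $ i) * multilinear_extension (marginal i f) (w i))"
    using multilinear_extension_mean_value[OF assms] by metis
  have le: "0 \<le> z $ i - x $ i" for i
    using assms by (simp add: less_eq_vec_def)
  show "(\<Sum>i\<in>UNIV. (z $ i - x $ i) * a i) \<le> multilinear_extension f z - multilinear_extension f x"
    if "\<And>w i. x \<le> w \<Longrightarrow> w \<le> z \<Longrightarrow> a i \<le> multilinear_extension (marginal i f) w"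
    unfolding eq by (intro sum_mono mult_left_mono that w le)
  show "multilinear_extension f z - multilinear_extension f x \<le> (\<Sum>i\<in>UNIV. (z $ i - x $ i) * a i)"
    if "\<And>w i. x \<le> w \<Longrightarrow> w \<le> z \<Longrightarrow> multilinear_extension (marginal i f) w \<le> a i"
    unfolding eq by (intro sum_mono mult_left_mono that w le)
qed

lemma cube_interval: "w \<in> cbox 0 1" if "x \<in> cbox 0 1" "z \<in> cbox 0 1" "x \<le> w" "w \<le> z"
  for w :: "real ^ 'n::finite"
  using that unfolding mem_unit_cube less_eq_vec_def by (metis order_trans)

text \<open>An antitone set function has nonpositive marginals, so no coordinate step upwards
  increases its extension. Applied to \<open>marginal i f\<close> for submodular \<open>f\<close>,
  this makes the partial derivatives antitone.\<close>

lemma multilinear_extension_antimono: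
  fixes f :: "'n::finite set \<Rightarrow> real"
  assumes "antimono f" and "x \<in> cbox 0 1" "z \<in> cbox 0 1" "x \<le> z"
  shows "multilinear_extension f z \<le> multilinear_extension f x"
proof -
  have "marginal i f A \<le> 0" for i A
    using antimonoD[OF assms(1), of "A - {i}" "insert i A"] by (auto simp: marginal_def)
  then have "multilinear_extension (marginal i f) w \<le> 0" if "x \<le> w" "w \<le> z" for i w
    using multilinear_extension_mono[of w "marginal i f" "\<lambda>_. 0"] cube_interval[of x z w] that assms
    by (simp add: multilinear_extension_const)
  from multilinear_extension_increment_le[OF assms(4) this]
  show ?thesis by simp
qed

section \<open>Marginal gains under submodularity and curvature\<close>

lemma antimono_marginal:
  assumes "submodular f"
  shows "antimono (marginal i f)"
proof (rule antimonoI)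
  fix S T :: "'a set"
  assume "S \<subseteq> T"
  \<comment> \<open>Removing \<open>i\<close> from both sets secures the premise
    \<open>e \<notin> T\<close> of submodularity even when \<open>i\<close> lies in
    \<open>T\<close>.\<close>
  then have "S - {i} \<subseteq> T - {i}" "i \<notin> T - {i}" by auto
  then have "f ((T - {i}) \<union> {i}) - f (T - {i}) \<le> f ((S - {i}) \<union> {i}) - f (S - {i})"
    using assms unfolding submodular_def by metis
  then show "marginal i f T \<le> marginal i f S"
    by (simp add: marginal_def)
qed

lemma marginal_le_singleton:
  assumes "submodular f" and "f {} = 0"
  shows "marginal i f A \<le> f {i}"
  using antimonoD[OF antimono_marginal[OF assms(1)], of "{}" A i] assms(2)
  by (simp add: marginal_def)

lemma marginal_nonneg: "mono f \<Longrightarrow> 0 \<le> marginal i f A"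
  using monoD[of f "A - {i}" "insert i A"] by (auto simp: marginal_def)

lemma finite_curvature_ratios: "finite (curvature_ratios f)"
proof -
  have "curvature_ratios f \<subseteq> (\<lambda>(S, e). (f (S \<union> {e}) - f S) / f {e}) ` UNIV"
    by (auto simp: curvature_ratios_def)
  then show ?thesis by (rule finite_subset) simp
qed

text \<open>\<open>S = {}\<close> gives the ratio 1, so the minimum is at most 1.\<close>

lemma curvature_nonneg:
  assumes "f {} = 0"
  shows "0 \<le> curvature f"
proof (cases "curvature_ratios f = {}")
  case False
  then obtain e where "f {e} > 0" by (auto simp: curvature_ratios_def)
  define r where "r = (f ({} \<union> {e}) - f {}) / f {e}"
  have "r \<in> curvature_ratios f"
    using \<open>f {e} > 0\<close> unfolding r_def curvature_ratios_def by blast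
  moreover have "r = 1"
    using \<open>f {e} > 0\<close> assms by (simp add: r_def)
  ultimately have "Min (curvature_ratios f) \<le> 1"
    using Min_le[OF finite_curvature_ratios] by blast
  then show ?thesis by (simp add: curvature_def)
qed (simp add: curvature_def)

lemma curvature_le_1:
  assumes "mono f"
  shows "curvature f \<le> 1"
proof -
  have "0 \<le> r" if r: "r \<in> curvature_ratios f" for r
  proof -
    obtain S e where "r = (f (S \<union> {e}) - f S) / f {e}" "f {e} > 0"
      using r unfolding curvature_ratios_def by blast
    then show ?thesis
      using monoD[OF assms subset_insertI[of S e]] by (simp add: divide_nonneg_pos)
  qed
  then show ?thesis
    using finite_curvature_ratios[of f] by (auto simp: curvature_def)
qed

text \<open>If \<open>f {i} > 0\<close>, the gain is \<open>f {i}\<close> times a ratio, which the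
  minimum bounds. If \<open>f {i} = 0\<close>, no ratio belongs to \<open>i\<close> and monotonicity
  suffices.\<close>

lemma curvature_marginal:
  assumes "mono f" and "\<And>S. f S \<ge> 0"
  shows "(1 - curvature f) * f {i} \<le> marginal i f A"
proof (cases "f {i} > 0")
  case True
  define r where "r = (f ((A - {i}) \<union> {i}) - f (A - {i})) / f {i}"
  have r: "r \<in> curvature_ratios f"
    using True unfolding r_def curvature_ratios_def by blast
  then have "1 - curvature f \<le> r"
    using finite_curvature_ratios[of f] by (auto simp: curvature_def)
  moreover have "marginal i f A = r * f {i}"
    using True by (simp add: r_def marginal_def)
  ultimately show ?thesis using True by simp
next
  case False
  with assms(2)[of "{i}"] have "f {i} = 0" by simp
  then show ?thesis using marginal_nonneg[OF assms(1)] by simp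
qed

section \<open>The gradient and the use of stationarity\<close>

text \<open>Along the axis \<open>i\<close> the extension is affine, and uniqueness of derivatives
  identifies its slope with the component of whichever gradient \<open>g\<close> is given.\<close>

lemma GDERIV_multilinear_extension_nth:
  fixes f :: "'n::finite set \<Rightarrow> real"
  assumes "GDERIV (multilinear_extension f) x :> g"
  shows "g $ i = multilinear_extension (marginal i f) x"
proof -
  \<comment> \<open>The base point is written as the value of the line at 0, to fit the chain
    rule.\<close>
  have F: "(multilinear_extension f has_derivative (\<lambda>h. h \<bullet> g)) (at (x + 0 *\<^sub>R axis i 1))"
    using assms by (simp add: gderiv_def)
  have "((\<lambda>t. x + t *\<^sub>R axis i 1) has_derivative (\<lambda>t. t *\<^sub>R axis i 1)) (at (0::real))"
    by (auto intro!: derivative_eq_intros)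
  from has_derivative_compose[OF this F]
  have "((\<lambda>t. multilinear_extension f (x + t *\<^sub>R axis i 1)) has_real_derivative g $ i) (at 0)"
    by (simp add: has_field_derivative_def inner_axis' mult.commute[of _ "g $ i"])
  moreover have "multilinear_extension f (x + t *\<^sub>R axis i 1)
      = multilinear_extension f x + t * multilinear_extension (marginal i f) x" for t
    using multilinear_extension_diff[of i "x + t *\<^sub>R axis i 1" x f] by (simp add: axis_def)
  then have "((\<lambda>t. multilinear_extension f (x + t *\<^sub>R axis i 1)) has_real_derivative
      multilinear_extension (marginal i f) x) (at 0)"
    by (auto intro!: derivative_eq_intros)
  ultimately show ?thesis by (rule DERIV_unique)
qed

theorem theorem1:
  fixes f :: "'n::finite set \<Rightarrow> real" and C :: "(real ^ 'n) set" and x :: "real ^ 'n"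
  assumes "\<And>S. f S \<ge> 0"
    and "mono f"
    and "submodular f"
    and "f {} = 0"
    and "C \<subseteq> cbox 0 1"
    and "stationary_point (multilinear_extension f) C x"
  shows "\<forall>y\<in>C. multilinear_extension f x \<ge> 1 / (1 + curvature f) * multilinear_extension f y"
proof
  fix y assume "y \<in> C"
  define F where "F = multilinear_extension f"
  define D where "D i = multilinear_extension (marginal i f)" for i
  define c where "c = curvature f"
  define u l where "u = (\<chi> i. max (x $ i) (y $ i))" and "l = (\<chi> i. min (x $ i) (y $ i))"
  obtain g where "x \<in> C" and g: "GDERIV F x :> g" and stat: "(y - x) \<bullet> g \<le> 0"
    using assms(6) \<open>y \<in> C\<close> unfolding stationary_point_def F_def by blast
  have x: "x \<in> cbox 0 1" and y: "y \<in> cbox 0 1"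
    using \<open>x \<in> C\<close> \<open>y \<in> C\<close> assms(5) by auto
  then have u: "u \<in> cbox 0 1" and l: "l \<in> cbox 0 1"
    by (auto simp: mem_unit_cube u_def l_def min_le_iff_disj le_max_iff_disj)
  have le: "x \<le> u" "y \<le> u" "l \<le> x"
    by (auto simp: less_eq_vec_def u_def l_def)
  have c: "0 \<le> c" "c \<le> 1"
    using curvature_nonneg[where f = f, OF assms(4)] curvature_le_1[where f = f, OF assms(2)] by (simp_all add: c_def)
  have D_le: "D i w \<le> f {i}" if "w \<in> cbox 0 1" for i w
    using multilinear_extension_mono[where f = "marginal i f", OF that marginal_le_singleton[where f = f, OF assms(3,4)]]
    by (simp add: D_def multilinear_extension_const)
  have D_ge: "(1 - c) * f {i} \<le> D i w" if "w \<in> cbox 0 1" for i w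
    using multilinear_extension_mono[where g = "marginal i f", OF that curvature_marginal[where f = f, OF assms(2,1)]]
    by (simp add: D_def c_def multilinear_extension_const)
  have D_anti: "D i w \<le> D i v" if "v \<in> cbox 0 1" "w \<in> cbox 0 1" "v \<le> w" for i v w
    unfolding D_def by (intro multilinear_extension_antimono antimono_marginal assms(3) that)
  note bounds = multilinear_extension_increment_bounds[where f = f, folded D_def F_def]
  \<comment> \<open>\<open>x\<close> is the least point between \<open>x\<close> and
    \<open>u\<close>, so \<open>D i x\<close> is an upper bound there; between \<open>l\<close> and
    \<open>x\<close> it is a lower bound.\<close>
  have "F u - F x \<le> (\<Sum>i\<in>UNIV. (u $ i - x $ i) * D i x)"
    by (rule bounds(2)) (auto intro: le x u D_anti cube_interval[OF x u])
  moreover have "(\<Sum>i\<in>UNIV. (x $ i - l $ i) * D i x) \<le> F x - F l"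
    by (rule bounds(1)) (auto intro: le x l D_anti cube_interval[OF l x])
  \<comment> \<open>\<open>u $ i - x $ i\<close> and \<open>x $ i - l $ i\<close> are the positive
    and negative parts of \<open>y $ i - x $ i\<close>.\<close>
  moreover have "(\<Sum>i\<in>UNIV. (u $ i - x $ i) * D i x) - (\<Sum>i\<in>UNIV. (x $ i - l $ i) * D i x)
      = (y - x) \<bullet> g"
    unfolding inner_vec_def sum_subtractf[symmetric]
      GDERIV_multilinear_extension_nth[OF g[unfolded F_def], folded D_def]
    by (intro sum.cong) (auto simp: u_def l_def max_def min_def algebra_simps)
  ultimately have "F u + F l \<le> 2 * F x"
    using stat by linarith
  moreover have "F l \<ge> 0"
    using multilinear_extension_mono[OF l, of "\<lambda>_. 0" f] assms(1)
    by (simp add: F_def multilinear_extension_const)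
  \<comment> \<open>This lets the term \<open>- c * F l\<close> be dropped in the final
    combination.\<close>
  then have "c * F l \<ge> 0"
    using c by simp
  moreover have "(\<Sum>i\<in>UNIV. (u $ i - y $ i) * ((1 - c) * f {i})) \<le> F u - F y"
    by (rule bounds(1)) (auto intro: le D_le D_ge cube_interval[OF y u])
  moreover have "F x - F l \<le> (\<Sum>i\<in>UNIV. (x $ i - l $ i) * f {i})"
    by (rule bounds(2)) (auto intro: le D_le D_ge cube_interval[OF l x])
  then have "(1 - c) * (F x - F l) \<le> (1 - c) * (\<Sum>i\<in>UNIV. (x $ i - l $ i) * f {i})"
    using c by (intro mult_left_mono) auto
  \<comment> \<open>\<open>u $ i - y $ i\<close> and \<open>x $ i - l $ i\<close> are both the
    positive part of \<open>x $ i - y $ i\<close>, which links the lower bound on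
    \<open>F u - F y\<close> to the upper bound on \<open>F x - F l\<close>.\<close>
  moreover have "(1 - c) * (\<Sum>i\<in>UNIV. (x $ i - l $ i) * f {i})
      = (\<Sum>i\<in>UNIV. (u $ i - y $ i) * ((1 - c) * f {i}))"
    unfolding sum_distrib_left
    by (intro sum.cong) (auto simp: u_def l_def max_def min_def)
  ultimately have "F y \<le> (1 + c) * F x"
    by (simp add: algebra_simps)
  then show "1 / (1 + curvature f) * multilinear_extension f y \<le> multilinear_extension f x"
    using c by (simp add: F_def c_def field_simps)
qed

end
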